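(* For every $a\in\mathbb{C}$ with $\tfrac23a+\tfrac12\notin\{0,-1,-2,\dots\}$, $$F\!\left(1-a,\tfrac12-\tfrac13a;\tfrac23a+\tfrac12;9-4\sqrt5\right)=\frac{5^{-5a/6}\,(\sqrt5-1)^{a-2}\,\Gamma(\tfrac13a+\tfrac14)\,\Gamma(\tfrac13a+\tfrac34)}{2^{-5a/3-1/2}\,\Gamma(\tfrac13a+\tfrac3{10})\,\Gamma(\tfrac13a+\tfrac7{10})}.$$
   Context: $F(a,b;c;x)=\sum_{n\ge0}\frac{(a,n)(b,n)}{(c,n)(1,n)}x^n$ with $(\alpha,n)=\Gamma(\alpha+n)/\Gamma(\alpha)$ is the Gauss hypergeometric series. For $t>0$ and $s\in\mathbb{C}$, $t^s=e^{s\log t}$ with real logarithm. $1/\Gamma$ is interpreted as $0$ at the poles of $\Gamma$. *)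

theory Defs
  imports "HOL-Analysis.Analysis"
begin

text \<open>
  The quotient \<open>\<Gamma>(\<alpha> + n) / \<Gamma>(\<alpha>)\<close> is read as the rising factorial
  \<open>\<alpha> (\<alpha> + 1) \<dots> (\<alpha> + n - 1)\<close>, i.e. \<^const>\<open>pochhammer\<close>. The two agree by
  \<open>pochhammer_Gamma\<close> unless \<open>\<alpha>\<close> is a pole of \<open>\<Gamma>\<close>, where the quotient is meant by
  continuity (so that the series terminates).
\<close>

definition hypergeo_term :: "complex \<Rightarrow> complex \<Rightarrow> complex \<Rightarrow> complex \<Rightarrow> nat \<Rightarrow> complex" where
  "hypergeo_term a b c x n =
     (pochhammer a n * pochhammer b n) / (pochhammer c n * pochhammer 1 n) * x ^ n"

definition hypergeo_F :: "complex \<Rightarrow> complex \<Rightarrow> complex \<Rightarrow> complex \<Rightarrow> complex" where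
  "hypergeo_F a b c x = (\<Sum>n. hypergeo_term a b c x n)"

end

theory Submission
  imports Defs "HOL-Complex_Analysis.Complex_Analysis" "HOL-Real_Asymp.Real_Asymp"
begin

text \<open>
  Write \<open>a = 3 b\<close> and let \<open>E(b)\<close> be the hypergeometric series and \<open>H(b)\<close> the product of powers and
  Gamma values on the right-hand side. The argument \<open>9 - 4 sqrt 5\<close> is special: there, the
  contiguous relations of the series degenerate to a first-order recurrence
  \<open>E(b + 1) = \<rho>(b) E(b)\<close> with a rational function \<open>\<rho>\<close> (lemma \<open>hypergeo_contiguous\<close>, a
  telescoping sum). The functional equation of Gamma gives \<open>H\<close> the same recurrence, so
  \<open>E / H\<close> has period \<open>1\<close> in \<open>b\<close>.

  A periodic function need not be constant, but this one grows too slowly to be anything else. On the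
  right half-plane, \<open>E\<close> is dominated by a binomial series and grows at most like
  \<open>exp (3 |Im b|)\<close> on a vertical strip (lemma \<open>norm_hypergeo_F_le\<close>); the Gamma quotient in
  \<open>1 / H\<close> is bounded (lemma \<open>Gamma_ratio_bounded\<close>). Since \<open>3 < 2 \<pi>\<close>, Liouville's theorem in
  the variable \<open>exp (2 \<pi> i b)\<close> shows that \<open>E / H\<close> is constant
  (lemma \<open>periodic_exponential_type_constant\<close>).

  The constant is found at \<open>b = 1/2\<close>, where the series reduces to its first term and the Gamma values
  are given by the reflection formula (lemma \<open>side_ratio_half\<close>). The series is holomorphic in
  its parameters (lemma \<open>holomorphic_on_hypergeo_F\<close>), and analytic continuation extends the identity
  from the right half-plane to all admissible \<open>b\<close>.
\<close>

section \<open>Convergence of the series and holomorphy in the parameters\<close>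

lemma hypergeo_term_Suc:
  "hypergeo_term a b c x (Suc n) =
     hypergeo_term a b c x n * ((a + of_nat n) * (b + of_nat n) / ((c + of_nat n) * of_nat (Suc n)) * x)"
  by (simp add: hypergeo_term_def pochhammer_rec' ac_simps)

text \<open>
  One ratio \<open>r < 1\<close> and one threshold \<open>N\<close> serve all parameters in a bounded region; this is
  what makes the convergence of the series locally uniform in the parameters. Beyond the threshold,
  \<open>c + n\<close> stays away from \<open>0\<close>.
\<close>

lemma hypergeo_term_ratio_bound:
  fixes R :: real and x :: complex
  assumes "norm x < 1"
  obtains r N where "0 < r" "r < 1"
    "\<And>a b c n. norm a \<le> R \<Longrightarrow> norm b \<le> R \<Longrightarrow> norm c \<le> R \<Longrightarrow> N \<le> n \<Longrightarrow>
       norm (hypergeo_term a b c x (Suc n)) \<le> r * norm (hypergeo_term a b c x n)"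
proof -
  define r where "r = (norm x + 1) / 2"
  have r: "0 < r" "r < 1" "norm x < r"
    using assms by (auto simp: r_def add_pos_nonneg intro: add_nonneg_pos)
  have "((\<lambda>n::nat. (real n + R)\<^sup>2 / ((real n - R) * real (Suc n)) * norm x) \<longlongrightarrow> 1 * norm x) at_top"
    by (intro tendsto_mult tendsto_const) real_asymp
  hence "eventually (\<lambda>n::nat. (real n + R)\<^sup>2 / ((real n - R) * real (Suc n)) * norm x < r) at_top"
    using r(3) by (intro order_tendstoD) auto
  moreover have "eventually (\<lambda>n::nat. real n > R) at_top"
    by real_asymp
  ultimately obtain N where N: "\<And>n. n \<ge> N \<Longrightarrow> real n > R"
      "\<And>n. n \<ge> N \<Longrightarrow> (real n + R)\<^sup>2 / ((real n - R) * real (Suc n)) * norm x < r"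
    by (metis (mono_tags, lifting) eventually_at_top_linorder eventually_conj)
  show ?thesis
  proof (rule that[OF r(1,2)])
    fix a b c :: complex and n :: nat
    assume R: "norm a \<le> R" "norm b \<le> R" "norm c \<le> R" and n: "N \<le> n"
    have R0: "R \<ge> 0"
      using R(1) norm_ge_zero[of a] by linarith
    have nR: "real n - R > 0"
      using N(1)[OF n] by simp
    have "norm (a + of_nat n) \<le> real n + R" "norm (b + of_nat n) \<le> real n + R"
      using norm_triangle_ineq[of a "of_nat n"] norm_triangle_ineq[of b "of_nat n"] R by simp_all
    moreover have "norm (c + of_nat n) \<ge> real n - R"
      using norm_diff_ineq[of "of_nat n" c] R by (simp add: add_ac)
    ultimately have "norm ((a + of_nat n) * (b + of_nat n) / ((c + of_nat n) * of_nat (Suc n)) * x)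
        \<le> (real n + R)\<^sup>2 / ((real n - R) * real (Suc n)) * norm x"
      unfolding norm_mult norm_divide norm_of_nat power2_eq_square using nR
      by (intro mult_right_mono frac_le mult_mono mult_nonneg_nonneg mult_pos_pos) (use R0 in auto)
    also have "\<dots> \<le> r"
      using N(2)[OF n] by simp
    finally show "norm (hypergeo_term a b c x (Suc n)) \<le> r * norm (hypergeo_term a b c x n)"
      unfolding hypergeo_term_Suc norm_mult[of "hypergeo_term a b c x n"]
      by (subst mult.commute[of r]) (rule mult_left_mono[OF _ norm_ge_zero])
  qed
qed

lemma summable_hypergeo_term:
  assumes "norm x < 1"
  shows   "summable (hypergeo_term a b c x)"
proof -
  define R where "R = Max {norm a, norm b, norm c}"
  obtain r N where "0 < r" "r < 1" and
    *: "\<And>a b c n. norm a \<le> R \<Longrightarrow> norm b \<le> R \<Longrightarrow> norm c \<le> R \<Longrightarrow> N \<le> n \<Longrightarrow>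
       norm (hypergeo_term a b c x (Suc n)) \<le> r * norm (hypergeo_term a b c x n)"
    by (rule hypergeo_term_ratio_bound[OF assms, of R]) (rule that)
  show ?thesis
    using \<open>r < 1\<close> by (rule summable_ratio_test[where N = N], intro *) (auto simp: R_def)
qed

lemma hypergeo_term_times_power_tendsto_0:
  assumes "norm x < 1"
  shows   "(\<lambda>n. of_nat n ^ m * hypergeo_term a b c x n) \<longlonglongrightarrow> 0"
proof -
  \<comment> \<open>The power of \<open>n\<close> is absorbed by moving to a slightly larger argument \<open>y\<close>.\<close>
  obtain y where y: "norm x < y" "y < 1"
    using assms dense by blast
  have y0: "y > 0"
    using y(1) norm_ge_zero[of x] by linarith
  have "hypergeo_term a b c (of_real y) \<longlonglongrightarrow> 0"
    using y y0 by (intro summable_LIMSEQ_zero summable_hypergeo_term) auto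
  moreover have "(\<lambda>n. of_nat n ^ m * (x / of_real y) ^ n) \<longlonglongrightarrow> 0"
  proof (rule tendsto_norm_zero_cancel)
    have "norm x / y \<ge> 0" "norm x / y < 1"
      using y y0 by (auto simp: field_simps)
    hence "(\<lambda>n. real n ^ m * (norm x / y) ^ n) \<longlonglongrightarrow> 0"
    proof (cases "norm x / y = 0")
      case True
      show ?thesis
        by (rule tendsto_eventually, rule eventually_mono[OF eventually_gt_at_top[of 0]]) (simp add: True)
    next
      case False
      have "(\<lambda>n. real n ^ m * u ^ n) \<longlonglongrightarrow> 0" if "0 < u" "u < 1" for u :: real
        using that by real_asymp
      from this[of "norm x / y"] show ?thesis
        using False \<open>norm x / y \<ge> 0\<close> \<open>norm x / y < 1\<close> by linarith
    qed
    thus "(\<lambda>n. norm (of_nat n ^ m * (x / of_real y) ^ n)) \<longlonglongrightarrow> 0"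
      using y0 by (simp add: norm_mult norm_power norm_divide)
  qed
  ultimately have "(\<lambda>n. hypergeo_term a b c (of_real y) n * (of_nat n ^ m * (x / of_real y) ^ n)) \<longlonglongrightarrow> 0 * 0"
    by (rule tendsto_mult)
  also have "(\<lambda>n. hypergeo_term a b c (of_real y) n * (of_nat n ^ m * (x / of_real y) ^ n)) =
             (\<lambda>n. of_nat n ^ m * hypergeo_term a b c x n)"
    using y0 by (auto simp: hypergeo_term_def fun_eq_iff field_simps power_divide)
  finally show ?thesis by simp
qed

lemma holomorphic_on_hypergeo_term:
  assumes "A holomorphic_on S" "B holomorphic_on S" "C holomorphic_on S"
    and "\<And>z. z \<in> S \<Longrightarrow> C z \<notin> \<int>\<^sub>\<le>\<^sub>0"
  shows "(\<lambda>z. hypergeo_term (A z) (B z) (C z) x n) holomorphic_on S"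
proof -
  have *: "pochhammer (C z) n \<noteq> 0" if "z \<in> S" for z
    using assms(4)[OF that] pochhammer_eq_0_imp_nonpos_Int by blast
  have "pochhammer (1 :: complex) n \<noteq> 0"
    by (simp add: pochhammer_fact[symmetric])
  thus ?thesis
    unfolding hypergeo_term_def
    by (intro holomorphic_intros assms) (auto simp: *)
qed

text \<open>
  The uniform ratio bound holds only from some index \<open>N\<close> on. The term of index \<open>N\<close> is continuous in
  the parameters, hence bounded on a compact disc, and the later terms are dominated by a geometric
  series starting from that bound.
\<close>

lemma holomorphic_on_hypergeo_F:
  assumes S: "open S" and x: "norm x < 1"
    and hol: "A holomorphic_on S" "B holomorphic_on S" "C holomorphic_on S"
    and C: "\<And>z. z \<in> S \<Longrightarrow> C z \<notin> \<int>\<^sub>\<le>\<^sub>0"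
  shows "(\<lambda>z. hypergeo_F (A z) (B z) (C z) x) holomorphic_on S"
proof (rule holomorphic_uniform_sequence[OF S])
  let ?t = "\<lambda>n z. hypergeo_term (A z) (B z) (C z) x n"
  show "(\<lambda>z. \<Sum>k<n. ?t k z) holomorphic_on S" for n
    by (intro holomorphic_intros holomorphic_on_hypergeo_term hol C)
  fix z assume "z \<in> S"
  then obtain d where d: "d > 0" "cball z d \<subseteq> S"
    using S open_contains_cball by blast
  have bdd: "\<exists>R. \<forall>w\<in>cball z d. norm (f w) \<le> R" if "f holomorphic_on S" for f :: "complex \<Rightarrow> complex"
  proof -
    have "compact (f ` cball z d)"
      using that d(2) holomorphic_on_imp_continuous_on holomorphic_on_subset
      by (intro compact_continuous_image) auto
    thus ?thesis
      using compact_imp_bounded[of "f ` cball z d"] by (auto simp: bounded_iff)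
  qed
  from bdd[OF hol(1)] bdd[OF hol(2)] bdd[OF hol(3)] obtain R1 R2 R3 where
    R: "\<forall>w\<in>cball z d. norm (A w) \<le> R1" "\<forall>w\<in>cball z d. norm (B w) \<le> R2"
       "\<forall>w\<in>cball z d. norm (C w) \<le> R3"
    by blast
  define R where "R = max R1 (max R2 R3)"
  have R': "R1 \<le> R" "R2 \<le> R" "R3 \<le> R"
    by (auto simp: R_def)
  have ABC: "norm (A w) \<le> R" "norm (B w) \<le> R" "norm (C w) \<le> R" if "w \<in> cball z d" for w
    using bspec[OF R(1) that] bspec[OF R(2) that] bspec[OF R(3) that] R' by linarith+
  obtain r N where r: "0 < r" "r < 1" and
    *: "\<And>a b c n. norm a \<le> R \<Longrightarrow> norm b \<le> R \<Longrightarrow> norm c \<le> R \<Longrightarrow> N \<le> n \<Longrightarrow>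
       norm (hypergeo_term a b c x (Suc n)) \<le> r * norm (hypergeo_term a b c x n)"
    by (rule hypergeo_term_ratio_bound[OF x, of R]) (rule that)
  obtain M where M: "\<forall>w\<in>cball z d. norm (?t N w) \<le> M"
    using bdd[OF holomorphic_on_hypergeo_term[OF hol C, of x N]] by auto
  have bound: "norm (?t (N + k) w) \<le> M * r ^ k" if w: "w \<in> cball z d" for w k
  proof (induction k)
    case 0
    show ?case using M w by simp
  next
    case (Suc k)
    have "norm (?t (N + Suc k) w) \<le> r * norm (?t (N + k) w)"
      using *[OF ABC[OF w], of "N + k"] by simp
    also have "\<dots> \<le> r * (M * r ^ k)"
      using Suc r by (intro mult_left_mono) auto
    finally show ?case by (simp add: mult_ac)
  qed
  have "uniform_limit (cball z d) (\<lambda>n w. \<Sum>k<n. ?t k w) (\<lambda>w. suminf (\<lambda>k. ?t k w)) sequentially"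
  proof (rule Weierstrass_m_test_ev)
    show "\<forall>\<^sub>F n in sequentially. \<forall>w\<in>cball z d. norm (?t n w) \<le> M / r ^ N * r ^ n"
      using eventually_ge_at_top[of N]
    proof eventually_elim
      case (elim n)
      then obtain k where "n = N + k" using le_Suc_ex by blast
      thus ?case using bound[of _ k] r by (auto simp: power_add)
    qed
    show "summable (\<lambda>n. M / r ^ N * r ^ n)"
      using r by (intro summable_mult summable_geometric) auto
  qed
  thus "\<exists>d>0. cball z d \<subseteq> S \<and> uniform_limit (cball z d) (\<lambda>n z. \<Sum>k<n. ?t k z)
          (\<lambda>z. hypergeo_F (A z) (B z) (C z) x) sequentially"
    using d unfolding hypergeo_F_def by blast
qed

section \<open>The recurrence at the argument 9 - 4 sqrt 5\<close>

text \<open>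
  With \<open>s = sqrt 5\<close>, the polynomial \<open>R(n) = 15 cert0 b n + 4 s cert1 b n\<close> is the numerator of a
  certificate for creative telescoping. Write \<open>v(n)\<close> for
  \<open>(-2 - 3 b, n) (-1/2 - b, n) / ((2 b + 5/2, n) n!) x^n\<close>, the summand with \<open>b + 1\<close> in place of
  \<open>b\<close>. The summand at \<open>b\<close> is a polynomial of degree six in \<open>n\<close> times \<open>v(n)\<close>. For a combination of the two
  summands to be the forward difference of \<open>n (2 b + 3/2 + n) R(n) v(n)\<close>, with \<open>R\<close> of degree four, the
  coefficients of \<open>R\<close> and the multiplier must satisfy seven linear equations in six
  unknowns. For \<open>x = 9 - 4 s\<close> this overdetermined system is solvable, and \<open>R\<close>
  is its solution, scaled to have integer coefficients.
\<close>

definition cert0 :: "complex \<Rightarrow> complex \<Rightarrow> complex" where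
  "cert0 b n = b * (- 19 - 40*n + 88*n^2 - 32*n^3) + b^2 * (- 169 - 108*n + 144*n^2)
     + b^3 * (- 456 - 40*n) - 372 * b^4"

definition cert1 :: "complex \<Rightarrow> complex \<Rightarrow> complex" where
  "cert1 b n = (- 8 + 12*n + 28*n^2 - 48*n^3 + 16*n^4) + b * (- 66 + 83*n + 90*n^2 - 80*n^3)
     + b^2 * (- 193 + 162*n + 76*n^2) + b^3 * (- 240 + 96*n) - 108 * b^4"

text \<open>
  The certificate identity splits into its part free of \<open>s\<close> and the
  coefficient of \<open>s\<close>, after \<open>s^2 = 5\<close> has been used. Each part is an identity of polynomials in
  \<open>b\<close> and \<open>n\<close>.
\<close>

lemma cert_rational_part:
  "500 * ((-2-3*b)*(-1-3*b)*(-3*b)*(-1/2-b)) * ((b+3/10)*(b+7/10))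
     - 1280 * ((n-2-3*b)*(n-1-3*b)*(n-3*b)*(n-1/2-b)*(2*b+1/2+n)*(2*b+3/2+n))
   = (135 * cert0 b (n+1) - 80 * cert1 b (n+1)) * ((n-2-3*b)*(n-1/2-b))
     - n * (2*b+3/2+n) * (15 * cert0 b n)"
  unfolding cert0_def cert1_def by algebra

lemma cert_sqrt5_part:
  "512 * ((n-2-3*b)*(n-1-3*b)*(n-3*b)*(n-1/2-b)*(2*b+1/2+n)*(2*b+3/2+n))
   = (36 * cert1 b (n+1) - 60 * cert0 b (n+1)) * ((n-2-3*b)*(n-1/2-b))
     - n * (2*b+3/2+n) * (4 * cert1 b n)"
  unfolding cert0_def cert1_def by algebra

lemma cert_identity:
  assumes "s^2 = 5"
  shows
  "500 * ((-2-3*b)*(-1-3*b)*(-3*b)*(-1/2-b)) * ((b+3/10)*(b+7/10))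
     - 256 * (5 - 2 * s) * ((n-2-3*b)*(n-1-3*b)*(n-3*b)*(n-1/2-b)*(2*b+1/2+n)*(2*b+3/2+n))
   = (9 - 4 * s) * (15 * cert0 b (n+1) + 4 * s * cert1 b (n+1)) * ((n-2-3*b)*(n-1/2-b))
     - n * (2*b+3/2+n) * (15 * cert0 b n + 4 * s * cert1 b n)"
  using cert_rational_part[of b n] cert_sqrt5_part[of n b] assms by algebra

lemma hypergeo_term_times_poly_tendsto_0:
  assumes "norm x < 1"
  shows   "(\<lambda>n. poly p (of_nat n) * hypergeo_term a b c x n) \<longlonglongrightarrow> 0"
proof -
  have "(\<lambda>n. \<Sum>i\<le>degree p. coeff p i * (of_nat n ^ i * hypergeo_term a b c x n)) \<longlonglongrightarrow>
          (\<Sum>i\<le>degree p. coeff p i * 0)"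
    by (intro tendsto_intros hypergeo_term_times_power_tendsto_0 assms)
  thus ?thesis
    by (simp add: poly_altdef sum_distrib_right sum_distrib_left mult_ac)
qed

text \<open>
  At a generic argument, shifting the parameters \<open>(1 - 3 b, 1/2 - b; 2 b + 1/2)\<close> by \<open>(-3, -1; 2)\<close>
  gives a contiguous relation between three series. At \<open>9 - 4 s\<close> one of them drops out,
  and a first-order recurrence in \<open>b\<close> remains. It is proved by telescoping with the
  certificate. The telescoping relation carries the common factor \<open>D\<close>, which has to be cancelled;
  this is the reason for the inequations assumed of \<open>b\<close>.
\<close>

lemma hypergeo_contiguous:
  assumes "b \<noteq> 0" "1 + 2 * b \<noteq> 0" "1 + 3 * b \<noteq> 0" "2 + 3 * b \<noteq> 0" and c: "2 * b + 1 / 2 \<notin> \<int>\<^sub>\<le>\<^sub>0"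
    and s: "s\<^sup>2 = 5" and s': "norm (9 - 4 * s) < 1"
  defines "E \<equiv> \<lambda>b. hypergeo_F (1 - 3 * b) (1 / 2 - b) (2 * b + 1 / 2) (9 - 4 * s)"
  shows "500 * ((b + 3 / 10) * (b + 7 / 10)) * E (b + 1) =
         256 * (5 - 2 * s) * ((2 * b + 1 / 2) * (2 * b + 3 / 2)) * E b"
proof -
  define x where "x = 9 - 4 * s"
  define D where "D = (-2-3*b)*(-1-3*b)*(-3*b)*(-1/2-b)"
  define c2 where "c2 = (2 * b + 1 / 2) * (2 * b + 3 / 2)"
  define W where "W = (\<lambda>n. (n-2-3*b)*(n-1-3*b)*(n-3*b)*(n-1/2-b)*(2*b+1/2+n)*(2*b+3/2+n))"
  define R where "R = (\<lambda>n. 15 * cert0 b n + 4 * s * cert1 b n)"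
  define t where "t = hypergeo_term (1 - 3 * b) (1 / 2 - b) (2 * b + 1 / 2) x"
  define t' where "t' = hypergeo_term (1 - 3 * (b + 1)) (1 / 2 - (b + 1)) (2 * (b + 1) + 1 / 2) x"
  define G where "G = (\<lambda>n. n * (2*b+3/2+n) * R n)"
  have "-2-3*b \<noteq> 0" "-1-3*b \<noteq> 0" "-3*b \<noteq> 0" "-1/2-b \<noteq> 0"
    using assms(1-4) by (auto simp: field_simps add_eq_0_iff)
  hence D: "D \<noteq> 0"
    by (simp add: D_def)
  have c_nz: "2 * b + 1 / 2 + of_nat n \<noteq> 0" for n
    using c by (metis plus_of_nat_eq_0_imp)
  from c_nz[of 0] c_nz[of 1] have c2: "c2 \<noteq> 0"
    by (simp add: c2_def add_ac)
  have c2nz: "2 * (b + 1) + 1 / 2 \<notin> \<int>\<^sub>\<le>\<^sub>0"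
  proof
    assume "2 * (b + 1) + 1 / 2 \<in> \<int>\<^sub>\<le>\<^sub>0"
    then obtain n where "2 * (b + 1) + 1 / 2 = - of_nat n"
      by (elim nonpos_Ints_cases')
    with c_nz[of "n + 2"] show False
      by (simp add: algebra_simps add_eq_0_iff)
  qed
  have poch1: "pochhammer a n * (a + of_nat n) = a * pochhammer (a + 1) n" for a :: complex and n
    using pochhammer_rec[of a n] pochhammer_rec'[of a n] by (simp add: mult_ac)
  have poch3: "pochhammer a n * ((a + of_nat n) * (a + 1 + of_nat n) * (a + 2 + of_nat n)) =
               a * (a + 1) * (a + 2) * pochhammer (a + 3) n" for a :: complex and n
  proof -
    have "pochhammer a (n + 3) = pochhammer a (3 + n)" by (simp add: add.commute)
    thus ?thesis unfolding pochhammer_product'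
      by (simp add: eval_nat_numeral pochhammer_rec' algebra_simps)
  qed
  \<comment> \<open>The quotient of the summands at \<open>b\<close> and at \<open>b + 1\<close> is a polynomial in \<open>n\<close>.\<close>
  have W: "W (of_nat n) * t' n = c2 * D * t n" for n
  proof -
    have A: "pochhammer (1 - 3 * (b + 1)) n * ((of_nat n - 2 - 3*b) * (of_nat n - 1 - 3*b) * (of_nat n - 3*b)) =
             (-2-3*b) * (-1-3*b) * (-3*b) * pochhammer (1 - 3 * b) n"
      using poch3[of "-2-3*b" n] by (simp add: algebra_simps)
    have B: "pochhammer (1 / 2 - (b + 1)) n * (of_nat n - 1/2 - b) = (1/2-(b+1)) * pochhammer (1 / 2 - b) n"
    proof -
      have e: "1/2-(b+1) + of_nat n = of_nat n - 1/2 - b" "1/2-(b+1) + 1 = 1/2 - b"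
        by simp_all
      show ?thesis
        using poch1[of "1/2-(b+1)" n] by (simp only: e)
    qed
    have C: "pochhammer (2 * b + 1 / 2) n * ((2*b+1/2+ of_nat n)*(2*b+3/2+ of_nat n)) =
             c2 * pochhammer (2 * (b + 1) + 1 / 2) n"
    proof -
      have "pochhammer (2 * b + 1 / 2) (n + 2) = pochhammer (2 * b + 1 / 2) (2 + n)"
        by (simp add: add.commute)
      thus ?thesis unfolding pochhammer_product'
        by (simp add: eval_nat_numeral pochhammer_rec' algebra_simps c2_def)
    qed
    have nz: "pochhammer (2 * b + 1 / 2) n \<noteq> 0" "pochhammer (2 * (b + 1) + 1 / 2) n \<noteq> 0"
             "pochhammer (1::complex) n \<noteq> 0"
      using c c2nz pochhammer_eq_0_imp_nonpos_Int by (blast, blast, simp add: pochhammer_fact[symmetric])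
    have *: "w1 * w2 * w3 * (A * B / (C2 * f) * X) = c2 * (d1 * d2) * (A3 * B1 / (C * f) * X)"
      if "A * w1 = d1 * A3" "B * w2 = d2 * B1" "C * w3 = c2 * C2" "C \<noteq> 0" "C2 \<noteq> 0" "f \<noteq> 0"
      for w1 w2 w3 A B C C2 f X c2 d1 d2 A3 B1 :: complex
    proof -
      have "w1 * w2 * w3 * A * B * C = (A * w1) * (B * w2) * (C * w3)"
        by (simp add: mult_ac)
      also have "\<dots> = c2 * (d1 * d2) * A3 * B1 * C2"
        unfolding that(1-3) by (simp add: mult_ac)
      finally show ?thesis using that(4-6) by (simp add: field_simps)
    qed
    show ?thesis
      unfolding t_def t'_def hypergeo_term_def using *[OF A B C nz] by (simp add: W_def D_def mult_ac)
  qed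
  have t'_Suc: "x * ((of_nat n-2-3*b)*(of_nat n-1/2-b)) * t' n =
       of_nat (Suc n) * (2*b+3/2+ of_nat (Suc n)) * t' (Suc n)" for n
  proof -
    define w m u v where "w = 2 * (b + 1) + 1 / 2 + of_nat n" and "m = (of_nat (Suc n) :: complex)"
      and "u = 1 - 3 * (b + 1) + of_nat n" and "v = 1 / 2 - (b + 1) + of_nat n"
    have e: "of_nat (Suc n) = m" "2*b+3/2+m = w" "of_nat n-2-3*b = u" "of_nat n-1/2-b = v"
      by (simp_all add: w_def u_def v_def m_def)
    have "w = 2*b+1/2+ of_nat (n + 2)"
      by (simp add: w_def)
    hence "w \<noteq> 0"
      using c_nz by metis
    moreover have "m \<noteq> 0"
      by (simp add: m_def del: of_nat_Suc)
    ultimately have "x * (u * v) * t' n = m * w * (t' n * (u * v / (w * m) * x))"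
      by simp
    also have "t' n * (u * v / (w * m) * x) = t' (Suc n)"
      by (simp only: t'_def hypergeo_term_Suc w_def m_def u_def v_def)
    finally show ?thesis
      unfolding e .
  qed
  have tele: "D * (500 * ((b+3/10)*(b+7/10)) * t' n - 256 * (5 - 2 * s) * c2 * t n) =
              G (of_nat (Suc n)) * t' (Suc n) - G (of_nat n) * t' n" for n
  proof -
    have "D * (500 * ((b+3/10)*(b+7/10)) * t' n - 256 * (5 - 2 * s) * c2 * t n) =
          500 * D * ((b+3/10)*(b+7/10)) * t' n - 256 * (5 - 2 * s) * (c2 * D * t n)"
      by (simp add: algebra_simps)
    also have "\<dots> = (500 * D * ((b+3/10)*(b+7/10)) - 256 * (5 - 2 * s) * W (of_nat n)) * t' n"
      unfolding W[symmetric] by (simp add: algebra_simps)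
    also have "500 * D * ((b+3/10)*(b+7/10)) - 256 * (5 - 2 * s) * W (of_nat n) =
               x * R (of_nat (Suc n)) * ((of_nat n-2-3*b)*(of_nat n-1/2-b)) - G (of_nat n)"
      using cert_identity[OF s, of b "of_nat n"] by (simp add: D_def W_def R_def x_def G_def add_ac)
    also have "\<dots> * t' n = R (of_nat (Suc n)) * (x * ((of_nat n-2-3*b)*(of_nat n-1/2-b)) * t' n) - G (of_nat n) * t' n"
      by (simp add: algebra_simps)
    also have "\<dots> = G (of_nat (Suc n)) * t' (Suc n) - G (of_nat n) * t' n"
      unfolding t'_Suc by (simp add: G_def mult_ac del: of_nat_Suc)
    finally show ?thesis .
  qed
  have nx: "norm x < 1"
    using s' by (simp add: x_def)
  have "(\<lambda>n. G (of_nat n) * t' n) \<longlonglongrightarrow> 0"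
  proof -
    define p where "p = [:0, 1:] * [:2*b+3/2, 1:] *
      (smult 15 (smult b [:-19, -40, 88, -32:] + smult (b^2) [:-169, -108, 144:] + smult (b^3) [:-456, -40:]
          + [:-372 * b^4:])
       + smult (4 * s) ([:-8, 12, 28, -48, 16:] + smult b [:-66, 83, 90, -80:] + smult (b^2) [:-193, 162, 76:]
          + smult (b^3) [:-240, 96:] + [:-108 * b^4:]))"
    have "G z = poly p z" for z
      unfolding G_def p_def R_def cert0_def cert1_def
      by (simp add: algebra_simps power2_eq_square power3_eq_cube power4_eq_xxxx)
    thus ?thesis
      unfolding t'_def by (simp add: hypergeo_term_times_poly_tendsto_0 nx)
  qed
  hence "(\<lambda>n. G (of_nat (Suc n)) * t' (Suc n) - G (of_nat n) * t' n) sums (0 - G (of_nat 0) * t' 0)"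
    by (rule telescope_sums)
  moreover have "0 - G (of_nat 0) * t' 0 = 0"
    by (simp add: G_def)
  moreover have "(\<lambda>n. D * (500 * ((b+3/10)*(b+7/10)) * t' n - 256 * (5 - 2 * s) * c2 * t n)) sums
                 (D * (500 * ((b+3/10)*(b+7/10)) * E (b + 1) - 256 * (5 - 2 * s) * c2 * E b))"
    unfolding E_def hypergeo_F_def t_def t'_def x_def using nx
    by (intro sums_mult sums_diff summable_sums summable_hypergeo_term) (simp_all add: x_def)
  ultimately have "D * (500 * ((b+3/10)*(b+7/10)) * E (b + 1) - 256 * (5 - 2 * s) * c2 * E b) = 0"
    unfolding tele by (simp only: sums_unique2)
  thus ?thesis
    using D by (simp add: c2_def)
qed

section \<open>Growth of the series and of the Gamma quotient\<close>

text \<open>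
  If the factors \<open>(b + n) / (c + n)\<close> are at most \<open>1\<close> in modulus, the series is dominated by
  the binomial series of \<open>(1 - |x|)\<close> to the power \<open>- |a|\<close>. Its growth in \<open>a\<close> is
  exponential with the small rate \<open>- ln (1 - |x|)\<close>.
\<close>

lemma norm_hypergeo_F_le:
  assumes x: "norm x < 1" and bc: "\<And>n. norm (b + of_nat n) \<le> norm (c + of_nat n)"
  shows   "norm (hypergeo_F a b c x) \<le> (1 - norm x) powr (- norm a)"
proof -
  define A where "A = norm a"
  define u where "u = (\<lambda>n. pochhammer A n / fact n * norm x ^ n)"
  have "(\<lambda>n. (- A gchoose n) * (- norm x) ^ n) sums (1 + - norm x) powr (- A)"
    using x by (intro gen_binomial_real) auto
  also have "(\<lambda>n. (- A gchoose n) * (- norm x) ^ n) = u"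
    by (simp add: u_def gbinomial_pochhammer fun_eq_iff power_mult_distrib[symmetric])
  finally have u: "u sums (1 - norm x) powr (- A)"
    by simp
  have le: "norm (hypergeo_term a b c x n) \<le> u n" for n
  proof (induction n)
    case 0
    show ?case by (simp add: hypergeo_term_def u_def)
  next
    case (Suc n)
    have "norm ((b + of_nat n) / (c + of_nat n)) \<le> 1"
      using bc[of n] by (cases "c + of_nat n = 0") (auto simp: norm_divide divide_le_eq_1)
    moreover have "norm (a + of_nat n) \<le> A + real n"
      using norm_triangle_ineq[of a "of_nat n"] by (simp add: A_def)
    ultimately have *: "norm (a + of_nat n) * norm ((b + of_nat n) / (c + of_nat n)) \<le> (A + real n) * 1"
      by (intro mult_mono) (auto simp: A_def)
    have "norm ((a + of_nat n) * (b + of_nat n) / ((c + of_nat n) * of_nat (Suc n)) * x) =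
          norm (a + of_nat n) * norm ((b + of_nat n) / (c + of_nat n)) * (norm x / real (Suc n))"
      by (simp add: norm_mult norm_divide del: of_nat_Suc)
    also have "\<dots> \<le> (A + real n) * 1 * (norm x / real (Suc n))"
      by (intro mult_right_mono *) auto
    finally have "norm ((a + of_nat n) * (b + of_nat n) / ((c + of_nat n) * of_nat (Suc n)) * x)
             \<le> (A + real n) / real (Suc n) * norm x"
      by simp
    hence "norm (hypergeo_term a b c x (Suc n)) \<le> u n * ((A + real n) / real (Suc n) * norm x)"
      unfolding hypergeo_term_Suc norm_mult[of "hypergeo_term a b c x n"]
      by (intro mult_mono Suc.IH order.trans[OF norm_ge_zero Suc.IH]) auto
    also have "\<dots> = u (Suc n)"
      by (simp add: u_def pochhammer_rec' field_simps)
    finally show ?case .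
  qed
  have "norm (hypergeo_F a b c x) \<le> suminf u"
    unfolding hypergeo_F_def using u le
    by (intro norm_suminf_le) (auto simp: sums_iff)
  thus ?thesis
    using u by (simp add: sums_iff A_def)
qed

text \<open>
  Since \<open>3/10 + 7/10 = 1/4 + 3/4\<close>, the exponential factors in the Euler limits cancel
  and the quotient of Gamma values is the infinite product of
  \<open>(w + 1/4) (w + 3/4) / ((w + 3/10) (w + 7/10)) = 1 - (9/400) / ((w + 3/10) (w + 7/10))\<close>
  over \<open>w = z + k\<close>. The factors differ from \<open>1\<close> by \<open>O(1 / k^2)\<close> uniformly on the half-plane.
\<close>

lemma Gamma_ratio_bounded:
  obtains M where "\<And>z::complex. Re z \<ge> 0 \<Longrightarrow>
    norm (Gamma (z + 3/10) * Gamma (z + 7/10) * (rGamma (z + 1/4) * rGamma (z + 3/4))) \<le> M"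
proof
  fix z :: complex assume z: "Re z \<ge> 0"
  define S where "S = (\<Sum>k. 1 / (real (Suc k))\<^sup>2)"
  define f where "f = (\<lambda>k. (z + 1/4 + of_nat k) * (z + 3/4 + of_nat k) /
                           ((z + 3/10 + of_nat k) * (z + 7/10 + of_nat k)))"
  have summ: "summable (\<lambda>k. 1 / (real (Suc k))\<^sup>2)"
    using inverse_power_summable[of 2, where 'a = real]
    by (subst summable_Suc_iff) (simp_all add: field_simps)
  have f_le: "norm (f k) \<le> exp (1 / (real (Suc k))\<^sup>2)" for k
  proof -
    have "3/10 * real (Suc k) \<le> Re (z + 3/10 + of_nat k)" "7/10 * real (Suc k) \<le> Re (z + 7/10 + of_nat k)"
      using z by auto
    hence *: "3/10 * real (Suc k) \<le> norm (z + 3/10 + of_nat k)" "7/10 * real (Suc k) \<le> norm (z + 7/10 + of_nat k)"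
      using complex_Re_le_cmod order_trans by blast+
    have "21/100 * (real (Suc k))\<^sup>2 = 3/10 * real (Suc k) * (7/10 * real (Suc k))"
      by (simp add: power2_eq_square algebra_simps)
    also have "\<dots> \<le> norm (z + 3/10 + of_nat k) * norm (z + 7/10 + of_nat k)"
      by (intro mult_mono *) auto
    finally have **: "21/100 * (real (Suc k))\<^sup>2 \<le> \<dots>" .
    have nz: "z + 3/10 + of_nat k \<noteq> 0" "z + 7/10 + of_nat k \<noteq> 0"
      using * by (auto simp del: of_nat_Suc)
    have "(z + 1/4 + of_nat k) * (z + 3/4 + of_nat k) = (z + 3/10 + of_nat k) * (z + 7/10 + of_nat k) - 9/400"
      by (simp add: field_simps)
    hence "f k = 1 - (9/400) / ((z + 3/10 + of_nat k) * (z + 7/10 + of_nat k))"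
      unfolding f_def using nz by (simp add: diff_divide_distrib)
    also have "norm \<dots> \<le> 1 + (9/400) / (norm (z + 3/10 + of_nat k) * norm (z + 7/10 + of_nat k))"
      by (rule order.trans[OF norm_triangle_ineq4]) (simp add: norm_divide norm_mult)
    also have "\<dots> \<le> 1 + (9/400) / (21/100 * (real (Suc k))\<^sup>2)"
      using ** nz by (intro add_left_mono divide_left_mono) auto
    also have "\<dots> \<le> 1 + 1 / (real (Suc k))\<^sup>2"
      by (simp add: divide_simps)
    also have "\<dots> \<le> exp (1 / (real (Suc k))\<^sup>2)"
      by (rule exp_ge_add_one_self)
    finally show ?thesis .
  qed
  have "norm (\<Prod>k\<le>n. f k) \<le> exp S" for n
  proof -
    have "norm (\<Prod>k\<le>n. f k) \<le> (\<Prod>k\<le>n. exp (1 / (real (Suc k))\<^sup>2))"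
      unfolding prod_norm[symmetric] by (intro prod_mono conjI f_le norm_ge_zero)
    also have "\<dots> = exp (\<Sum>k\<le>n. 1 / (real (Suc k))\<^sup>2)"
      by (simp add: exp_sum)
    also have "(\<Sum>k\<le>n. 1 / (real (Suc k))\<^sup>2) \<le> S"
      unfolding S_def by (intro sum_le_suminf summ) auto
    finally show ?thesis by simp
  qed
  moreover have "Gamma_series (z + 3/10) n * Gamma_series (z + 7/10) n *
      (rGamma_series (z + 1/4) n * rGamma_series (z + 3/4) n) = (\<Prod>k\<le>n. f k)" for n
  proof -
    define L where "L = complex_of_real (ln (real n))"
    have "exp ((z + 3/10) * L) * exp ((z + 7/10) * L) = exp ((z + 1/4) * L) * exp ((z + 3/4) * L)"
      by (simp add: exp_add[symmetric] algebra_simps)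
    moreover have "(\<Prod>k\<le>n. f k) = pochhammer (z + 1/4) (n+1) * pochhammer (z + 3/4) (n+1) /
        (pochhammer (z + 3/10) (n+1) * pochhammer (z + 7/10) (n+1))"
      by (simp add: f_def prod_dividef prod.distrib pochhammer_Suc_prod atLeast0AtMost)
    ultimately show ?thesis
      unfolding Gamma_series_def rGamma_series_def L_def[symmetric]
      by (simp add: field_simps del: exp_add)
  qed
  moreover have "(\<lambda>n. Gamma_series (z + 3/10) n * Gamma_series (z + 7/10) n *
      (rGamma_series (z + 1/4) n * rGamma_series (z + 3/4) n)) \<longlonglongrightarrow>
      Gamma (z + 3/10) * Gamma (z + 7/10) * (rGamma (z + 1/4) * rGamma (z + 3/4))"
    by (intro tendsto_intros)
  ultimately show "norm (Gamma (z + 3/10) * Gamma (z + 7/10) * (rGamma (z + 1/4) * rGamma (z + 3/4)))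
      \<le> exp (\<Sum>k. 1 / (real (Suc k))\<^sup>2)"
    unfolding S_def by (intro tendsto_upperbound[OF tendsto_norm]) auto
qed

section \<open>Periodic functions of small exponential type\<close>

text \<open>
  A function of period \<open>1\<close> is a function \<open>q\<close> of \<open>w = exp (2 \<pi> i z)\<close> on the punctured plane. Growth
  of type \<open>k < 2 \<pi>\<close> in the imaginary direction means \<open>|q w| \<le> C |w|^\<kappa>\<close> near infinity and
  \<open>|q w| \<le> C |w|^(-\<kappa>)\<close> near \<open>0\<close>, with \<open>\<kappa> = k / (2 \<pi>) < 1\<close>. So the singularity at \<open>0\<close> is removable,
  and the resulting entire function grows more slowly than linearly and is constant.
\<close>

lemma periodic_exponential_type_constant:
  fixes p :: "complex \<Rightarrow> complex" and C k :: real
  assumes hol: "p holomorphic_on {z. Re z > 0}"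
    and per: "\<And>z. Re z > 0 \<Longrightarrow> p (z + 1) = p z"
    and bound: "\<And>z. 1 / 2 \<le> Re z \<Longrightarrow> Re z \<le> 3 / 2 \<Longrightarrow> norm (p z) \<le> C * exp (k * \<bar>Im z\<bar>)"
    and k: "0 \<le> k" "k < 2 * pi"
  obtains c where "\<And>z. Re z > 0 \<Longrightarrow> p z = c"
proof -
  have per_nat: "p (z + of_nat n) = p z" if "Re z > 0" for z n
  proof (induction n)
    case (Suc n)
    show ?case using per[of "z + of_nat n"] Suc that by (simp add: add_ac)
  qed auto
  have per_int: "p (z + of_int m) = p z" if "Re z > 0" "Re (z + of_int m) > 0" for z m
  proof (cases "m \<ge> 0")
    case True
    thus ?thesis using per_nat[of z "nat m"] that by simp
  next
    case False
    thus ?thesis using per_nat[of "z + of_int m" "nat (-m)"] that by simp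
  qed
  define l where "l = (\<lambda>w. Ln w / (2 * of_real pi * \<i>))"
  have Re_l: "-1/2 < Re (l w)" "Re (l w) \<le> 1/2" if "w \<noteq> 0" for w
    using that mpi_less_Im_Ln[of w] Im_Ln_le_pi[of w] by (simp_all add: l_def Re_divide power2_eq_square field_simps)
  have Im_l: "\<bar>Im (l w)\<bar> = \<bar>ln (norm w)\<bar> / (2 * pi)" if "w \<noteq> 0" for w
    using that by (simp add: l_def Im_divide power2_eq_square field_simps abs_mult)
  have exp_l: "exp (2 * of_real pi * \<i> * l w) = w" if "w \<noteq> 0" for w
    using that by (simp add: l_def)
  define q where "q = (\<lambda>w. p (l w + 1))"
  have q: "q (exp (2 * of_real pi * \<i> * z)) = p z" if z: "Re z > 0" for z
  proof -
    define w where "w = exp (2 * of_real pi * \<i> * z)"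
    have w: "w \<noteq> 0" by (simp add: w_def)
    have "exp (2 * of_real pi * \<i> * l w) = exp (2 * of_real pi * \<i> * z)"
      using exp_l[OF w] by (simp add: w_def)
    then obtain n :: int where "2 * of_real pi * \<i> * l w = 2 * of_real pi * \<i> * z + (of_int (2 * n) * pi) * \<i>"
      unfolding exp_eq by blast
    hence "2 * of_real pi * \<i> * l w = 2 * of_real pi * \<i> * (z + of_int n)"
      by (simp add: algebra_simps)
    hence "l w = z + of_int n"
      by simp
    hence *: "l w + 1 = z + of_int (n + 1)"
      by simp
    have "Re (l w + 1) > 0"
      using Re_l(1)[OF w] by simp
    thus ?thesis
      using per_int[OF z, of "n + 1"] unfolding q_def w_def[symmetric] * by simp
  qed
  \<comment> \<open>The branch cut of the logarithm disappears by periodicity: on the plane cut along the positive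
      axis, \<open>q\<close> is given by the same formula with the logarithm of \<open>-w\<close> and half a period added.\<close>
  have hol_q: "q holomorphic_on -{0}"
  proof -
    have hol_Ln: "(\<lambda>w. p (l w + c)) holomorphic_on (-\<real>\<^sub>\<le>\<^sub>0)" if "Re c \<ge> 1" for c
    proof -
      have "(\<lambda>w. l w + c) holomorphic_on (-\<real>\<^sub>\<le>\<^sub>0)"
        unfolding l_def by (intro holomorphic_on_add holomorphic_on_divide holomorphic_on_const holomorphic_on_Ln) auto
      moreover have "(\<lambda>w. l w + c) ` (-\<real>\<^sub>\<le>\<^sub>0) \<subseteq> {z. Re z > 0}"
      proof (rule image_subsetI)
        fix w :: complex assume "w \<in> -\<real>\<^sub>\<le>\<^sub>0"
        hence "w \<noteq> 0" by auto
        thus "l w + c \<in> {z. Re z > 0}"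
          using Re_l(1)[of w] that by simp
      qed
      ultimately show ?thesis
        using holomorphic_on_compose_gen[OF _ hol] by (auto simp: o_def)
    qed
    have "q holomorphic_on (-\<real>\<^sub>\<le>\<^sub>0)"
      using hol_Ln[of 1] by (simp add: q_def)
    moreover have "q holomorphic_on (uminus ` (-\<real>\<^sub>\<le>\<^sub>0))"
    proof -
      have "(\<lambda>w. p (l (-w) + 3/2)) holomorphic_on (uminus ` (-\<real>\<^sub>\<le>\<^sub>0))"
        by (rule holomorphic_on_compose_gen[OF _ hol_Ln[of "3/2"], unfolded o_def])
           (auto intro: holomorphic_on_minus[OF holomorphic_on_ident])
      moreover have "p (l (-w) + 3/2) = q w" if "w \<in> uminus ` (-\<real>\<^sub>\<le>\<^sub>0)" for w
      proof -
        have w: "-w \<noteq> 0" using that by auto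
        have "2 * of_real pi * \<i> * (l (-w) + 3/2) = 2 * of_real pi * \<i> * l (-w) + \<i> * of_real pi + 2 * of_real pi * \<i>"
          by (simp add: algebra_simps)
        hence "exp (2 * of_real pi * \<i> * (l (-w) + 3/2)) = exp (2 * of_real pi * \<i> * l (-w)) * exp (\<i> * of_real pi) * exp (2 * of_real pi * \<i>)"
          by (simp only: exp_add)
        also have "\<dots> = w"
          using exp_l[OF w] by simp
        finally have "exp (2 * of_real pi * \<i> * (l (-w) + 3/2)) = w" .
        moreover have "Re (l (-w) + 3/2) > 0"
          using Re_l(1)[OF w] by simp
        ultimately show ?thesis
          using q[of "l (-w) + 3/2"] by simp
      qed
      ultimately show ?thesis
        by (rule holomorphic_transform)
    qed
    moreover have "open (uminus ` (-\<real>\<^sub>\<le>\<^sub>0 :: complex set))"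
      by (intro open_negations) (auto intro: closed_nonpos_Reals_complex)
    ultimately have "q holomorphic_on ((-\<real>\<^sub>\<le>\<^sub>0) \<union> uminus ` (-\<real>\<^sub>\<le>\<^sub>0))"
      by (intro holomorphic_on_Un) (auto intro: closed_nonpos_Reals_complex)
    moreover have "-{0} \<subseteq> (-\<real>\<^sub>\<le>\<^sub>0) \<union> uminus ` (-\<real>\<^sub>\<le>\<^sub>0 :: complex set)"
    proof
      fix w :: complex assume "w \<in> -{0}"
      show "w \<in> (-\<real>\<^sub>\<le>\<^sub>0) \<union> uminus ` (-\<real>\<^sub>\<le>\<^sub>0)"
      proof (cases "w \<in> \<real>\<^sub>\<le>\<^sub>0")
        case True
        hence "-w \<notin> \<real>\<^sub>\<le>\<^sub>0"
          using \<open>w \<in> -{0}\<close> by (auto simp: complex_nonpos_Reals_iff complex_eq_iff)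
        thus ?thesis using image_eqI[of w uminus "-w" "-\<real>\<^sub>\<le>\<^sub>0"] by simp
      qed auto
    qed
    ultimately show ?thesis
      by (rule holomorphic_on_subset)
  qed
  define \<kappa> where "\<kappa> = k / (2 * pi)"
  have \<kappa>: "0 \<le> \<kappa>" "\<kappa> < 1"
    using k by (auto simp: \<kappa>_def)
  have q_le: "norm (q w) \<le> C * exp (\<kappa> * \<bar>ln (norm w)\<bar>)" if "w \<noteq> 0" for w
    using bound[of "l w + 1"] Re_l[OF that] Im_l[OF that] by (simp add: q_def \<kappa>_def)
  have C: "C \<ge> 0"
    using order.trans[OF norm_ge_zero q_le[of 1]] by simp
  have "((\<lambda>w. (w - 0) * q w) \<longlongrightarrow> 0) (at 0)"
  proof (rule Lim_null_comparison)
    show "eventually (\<lambda>w. norm ((w - 0) * q w) \<le> C * norm w powr (1 - \<kappa>)) (at 0)"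
      unfolding eventually_at
    proof (intro exI[of _ 1] conjI ballI impI)
      fix w :: complex assume "w \<noteq> 0 \<and> dist w 0 < 1"
      hence w: "w \<noteq> 0" "norm w < 1" by auto
      have "norm w * norm (q w) \<le> norm w * (C * exp (\<kappa> * \<bar>ln (norm w)\<bar>))"
        using w by (intro mult_left_mono q_le) auto
      also have "\<bar>ln (norm w)\<bar> = - ln (norm w)"
        using w by (simp add: ln_less_zero)
      also have "norm w * (C * exp (\<kappa> * (- ln (norm w)))) = C * norm w powr (1 - \<kappa>)"
        using w by (simp add: powr_def exp_diff exp_minus field_simps)
      finally show "norm ((w - 0) * q w) \<le> C * norm w powr (1 - \<kappa>)"
        by (simp add: norm_mult)
    qed auto
    have "((\<lambda>w::complex. C * norm w powr (1 - \<kappa>)) \<longlongrightarrow> C * 0 powr (1 - \<kappa>)) (at 0)"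
      using \<kappa> by (intro tendsto_intros tendsto_powr') (auto intro!: tendsto_eq_intros)
    thus "((\<lambda>w::complex. C * norm w powr (1 - \<kappa>)) \<longlongrightarrow> 0) (at 0)"
      by simp
  qed
  moreover have "q holomorphic_on UNIV - {0}"
    using hol_q by (simp add: Compl_eq_Diff_UNIV)
  ultimately obtain g where g: "g holomorphic_on UNIV" "\<And>w. w \<noteq> 0 \<Longrightarrow> g w = q w"
    using holomorphic_on_extend_lim[of q UNIV 0] by auto
  \<comment> \<open>Cauchy's estimate on circles of radius \<open>r\<close>, as \<open>r\<close> tends to infinity.\<close>
  have deriv_g: "deriv g \<xi> = 0" for \<xi>
  proof -
    have le: "norm (deriv g \<xi>) \<le> C * (2 * r) powr \<kappa> / r" if r: "r > norm \<xi> + 1" for r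
    proof -
      have r0: "r > 0" using r norm_ge_zero[of \<xi>] by linarith
      have "norm ((deriv ^^ 1) g \<xi>) \<le> fact 1 * (C * (2 * r) powr \<kappa>) / r ^ 1"
      proof (rule Cauchy_inequality)
        show "g holomorphic_on ball \<xi> r" "continuous_on (cball \<xi> r) g"
          using g(1) by (auto intro: holomorphic_on_subset holomorphic_on_imp_continuous_on)
        fix w assume w: "norm (\<xi> - w) = r"
        have w1: "norm w \<ge> 1"
          using norm_triangle_ineq4[of \<xi> w] w r by linarith
        have w2: "norm w \<le> 2 * r"
          using norm_triangle_ineq4[of \<xi> "\<xi> - w"] w r by simp
        have "norm (g w) \<le> C * exp (\<kappa> * \<bar>ln (norm w)\<bar>)"
          using q_le[of w] g(2)[of w] w1 by fastforce
        also have "\<bar>ln (norm w)\<bar> = ln (norm w)"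
          using w1 by simp
        also have "exp (\<kappa> * ln (norm w)) \<le> exp (\<kappa> * ln (2 * r))"
          using \<kappa> w1 w2 by (intro exp_mono mult_left_mono ln_mono) auto
        also have "exp (\<kappa> * ln (2 * r)) = (2 * r) powr \<kappa>"
          using r0 by (simp add: powr_def)
        finally show "norm (g w) \<le> C * (2 * r) powr \<kappa>"
          using C by (simp add: mult_left_mono)
      qed (use r0 in auto)
      thus ?thesis by simp
    qed
    have "((\<lambda>r. C * (2 * r) powr \<kappa> / r) \<longlongrightarrow> 0) at_top"
      using \<kappa> by real_asymp
    hence "norm (deriv g \<xi>) \<le> 0"
      by (rule tendsto_lowerbound)
         (auto intro: eventually_mono[OF eventually_gt_at_top[of "norm \<xi> + 1"] le])
    thus ?thesis by simp
  qed
  have "(g has_field_derivative 0) (at w)" for w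
    using holomorphic_derivI[OF g(1) open_UNIV, of w] deriv_g[of w] by simp
  hence "\<exists>c. \<forall>w. g w = c"
    using has_field_derivative_zero_constant[of UNIV g] by auto
  then obtain c where c: "\<And>w. g w = c" by blast
  show ?thesis
  proof (rule that)
    fix z :: complex assume "Re z > 0"
    thus "p z = c"
      using q[of z] g(2)[of "exp (2 * of_real pi * \<i> * z)"] c by simp
  qed
qed

section \<open>Comparison of the two sides\<close>

lemma sqrt5_bounds: "11/5 < sqrt 5" "sqrt 5 < 9/4"
  by (rule real_less_rsqrt, simp add: power2_eq_square, rule real_less_lsqrt, simp_all add: power2_eq_square)

text \<open>
  For \<open>t = \<pi> / 5\<close> the relation \<open>sin (2 t) = sin (3 t)\<close> is a quadratic equation for \<open>cos t\<close>.
\<close>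

lemma sin_pi_fifth_squared: "(sin (pi / 5))\<^sup>2 = (5 - sqrt 5) / 8"
proof -
  define t where "t = pi / 5"
  have s0: "sin t > 0" and c0: "cos t > 0"
    unfolding t_def by (auto intro!: sin_gt_zero cos_gt_zero simp: pi_gt_zero)
  have "sin (2 * t) = sin (3 * t)"
    using sin_pi_minus[of "2 * t"] by (simp add: t_def)
  also have "sin (3 * t) = sin (2 * t + t)"
    by simp
  also have "\<dots> = 2 * sin t * cos t * cos t + ((cos t)\<^sup>2 - (sin t)\<^sup>2) * sin t"
    unfolding sin_add sin_double cos_double ..
  finally have "sin t * (2 * cos t) = sin t * (3 * (cos t)\<^sup>2 - (sin t)\<^sup>2)"
    unfolding sin_double by (simp add: algebra_simps power2_eq_square)
  hence "2 * cos t = 3 * (cos t)\<^sup>2 - (sin t)\<^sup>2"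
    using s0 by simp
  hence "4 * (cos t)\<^sup>2 = 2 * cos t + 1"
    using sin_cos_squared_add[of t] by linarith
  hence "(4 * cos t - 1)\<^sup>2 = 5"
    by (simp add: power2_eq_square algebra_simps)
  moreover have "4 * cos t - 1 > - sqrt 5"
    using c0 sqrt5_bounds by linarith
  ultimately have c: "4 * cos t - 1 = sqrt 5"
    by (smt (verit) real_sqrt_abs)
  have "8 * (sin t)\<^sup>2 = 8 - 8 * (cos t)\<^sup>2"
    using sin_cos_squared_add[of t] by linarith
  also have "\<dots> = 6 - 4 * cos t"
    using \<open>4 * (cos t)\<^sup>2 = 2 * cos t + 1\<close> by simp
  also have "\<dots> = 5 - sqrt 5"
    using c by simp
  finally show ?thesis by (simp add: t_def)
qed

text \<open>
  The left-hand side of the theorem at \<open>a = 3 b\<close>. In the variable \<open>b\<close> the recurrence has step \<open>1\<close>.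
\<close>

definition hypergeo_side :: "complex \<Rightarrow> complex" where
  "hypergeo_side b = hypergeo_F (1 - 3 * b) (1 / 2 - b) (2 * b + 1 / 2) (of_real (9 - 4 * sqrt 5))"

text \<open>
  In \<open>b = a / 3\<close>, the powers of \<open>5\<close>, \<open>sqrt 5 - 1\<close> and \<open>2\<close> on the right-hand side combine to a single
  exponential, \<open>exp_factor\<close>. The exponential of its slope is the constant factor in the recurrence.
\<close>

definition log_multiplier :: real where
  "log_multiplier = 3 * ln (sqrt 5 - 1) + 5 * ln 2 - 5 * ln (sqrt 5)"

definition exp_factor :: "complex \<Rightarrow> complex" where
  "exp_factor b = exp (of_real log_multiplier * b + of_real (ln 2 / 2 - 2 * ln (sqrt 5 - 1)))"

lemma arg_bounds: "0 < 9 - 4 * sqrt 5" "9 - 4 * sqrt 5 < 1/2"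
  using sqrt5_bounds by linarith+

lemma exp_log_multiplier: "exp log_multiplier = 256 * (5 - 2 * sqrt 5) / 125"
proof -
  define s where "s = sqrt 5"
  have s: "s > 1" "s ^ 2 = 5" by (auto simp: s_def)
  have "log_multiplier = ln ((s - 1) ^ 3 * 2 ^ 5 / s ^ 5)"
    using s(1) ln_realpow[of 2 5] by (simp add: log_multiplier_def s_def[symmetric] ln_mult ln_div ln_realpow)
  moreover have "(s - 1) ^ 3 * 2 ^ 5 / s ^ 5 > 0"
    using s(1) by simp
  ultimately have "exp log_multiplier = (s - 1) ^ 3 * 2 ^ 5 / s ^ 5"
    by (metis exp_ln)
  also have "\<dots> = 256 * (5 - 2 * s) / 125"
  proof -
    have "(s - 1) ^ 3 = s * s\<^sup>2 - 3 * s\<^sup>2 + 3 * s - 1"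
      by (simp add: power3_eq_cube power2_eq_square algebra_simps)
    moreover have "s ^ 5 = s * (s\<^sup>2 * s\<^sup>2)"
      by (simp add: eval_nat_numeral)
    moreover have "s * s = 5"
      using s(2) by (simp add: power2_eq_square)
    ultimately show ?thesis using s(1) unfolding s(2) by (simp add: field_simps)
  qed
  finally show ?thesis by (simp add: s_def)
qed

lemma quarter_shifts_not_nonpos_Int:
  "2 * b + 1 / 2 \<notin> \<int>\<^sub>\<le>\<^sub>0 \<Longrightarrow> b + 1 / 4 \<notin> \<int>\<^sub>\<le>\<^sub>0 \<and> b + 3 / 4 \<notin> (\<int>\<^sub>\<le>\<^sub>0 :: complex set)"
proof (rule ccontr)
  assume *: "2 * b + 1 / 2 \<notin> \<int>\<^sub>\<le>\<^sub>0" "\<not> (b + 1 / 4 \<notin> \<int>\<^sub>\<le>\<^sub>0 \<and> b + 3 / 4 \<notin> \<int>\<^sub>\<le>\<^sub>0)"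
  then obtain n where "b + 1 / 4 = - of_nat n \<or> b + 3 / 4 = - of_nat n"
    by (auto elim!: nonpos_Ints_cases')
  hence "2 * b + 1 / 2 = - of_nat (2 * n) \<or> 2 * b + 1 / 2 = - of_nat (2 * n + 1)"
  proof
    assume "b + 1 / 4 = - of_nat n"
    hence "2 * (b + 1 / 4) = 2 * (- of_nat n)" by simp
    thus ?thesis by (simp add: algebra_simps)
  next
    assume "b + 3 / 4 = - of_nat n"
    hence "b = - of_nat n - 3 / 4" by (simp add: algebra_simps)
    thus ?thesis by simp
  qed
  with *(1) show False
    using minus_of_nat_in_nonpos_Ints by metis
qed

lemma nonpos_Int_Re_le: "z \<in> \<int>\<^sub>\<le>\<^sub>0 \<Longrightarrow> Re z \<le> 0"
  by (auto elim!: nonpos_Ints_cases')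

lemma Re_pos_not_nonpos_Int: "Re z > 0 \<Longrightarrow> z \<notin> \<int>\<^sub>\<le>\<^sub>0"
  using nonpos_Int_Re_le by fastforce

definition side_ratio :: "complex \<Rightarrow> complex" where
  "side_ratio b = hypergeo_side b * inverse (exp_factor b) *
     (Gamma (b + 3/10) * Gamma (b + 7/10) * (rGamma (b + 1/4) * rGamma (b + 3/4)))"

lemma hypergeo_side_plus1:
  assumes "Re b > 0"
  shows "(b + 3/10) * (b + 7/10) * hypergeo_side (b + 1) = of_real (exp log_multiplier) * ((b + 1/4) * (b + 3/4)) * hypergeo_side b"
proof -
  define s where "s = complex_of_real (sqrt 5)"
  have gen: "A * L = K / 125 * Z * R" if "500 * A * L = K * (4 * Z) * R" for A L K Z R :: complex
    using that by (simp add: field_simps)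
  have x: "complex_of_real (9 - 4 * sqrt 5) = 9 - 4 * s"
    by (simp add: s_def)
  have "Re b \<noteq> 0" "Re (1 + 2 * b) \<noteq> 0" "Re (1 + 3 * b) \<noteq> 0" "Re (2 + 3 * b) \<noteq> 0"
    using assms by auto
  hence "b \<noteq> 0" "1 + 2 * b \<noteq> 0" "1 + 3 * b \<noteq> 0" "2 + 3 * b \<noteq> 0"
    by (metis zero_complex.sel(1))+
  moreover have "2 * b + 1 / 2 \<notin> \<int>\<^sub>\<le>\<^sub>0"
    using assms by (intro Re_pos_not_nonpos_Int) auto
  moreover have "s ^ 2 = 5"
    by (simp add: s_def of_real_power[symmetric] del: of_real_power)
  moreover have "norm (9 - 4 * s) < 1"
    using arg_bounds unfolding x[symmetric] norm_of_real by linarith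
  ultimately have "500 * ((b + 3 / 10) * (b + 7 / 10)) * hypergeo_side (b + 1) =
         256 * (5 - 2 * s) * ((2 * b + 1 / 2) * (2 * b + 3 / 2)) * hypergeo_side b"
    unfolding hypergeo_side_def x by (rule hypergeo_contiguous)
  also have "(2 * b + 1 / 2) * (2 * b + 3 / 2) = 4 * ((b + 1/4) * (b + 3/4))"
    by (simp add: field_simps)
  finally have "(b + 3/10) * (b + 7/10) * hypergeo_side (b + 1) =
      256 * (5 - 2 * s) / 125 * ((b + 1/4) * (b + 3/4)) * hypergeo_side b"
    by (rule gen)
  thus ?thesis
    by (simp add: exp_log_multiplier s_def)
qed

lemma side_ratio_plus1:
  assumes "Re b > 0"
  shows   "side_ratio (b + 1) = side_ratio b"
proof -
  have nz: "b + 1/4 \<noteq> 0" "b + 3/4 \<noteq> 0" "b + 3/10 \<noteq> 0" "b + 7/10 \<noteq> 0"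
    using assms by (auto simp: complex_eq_iff)
  have sc: "exp_factor (b + 1) = of_real (exp log_multiplier) * exp_factor b"
    by (simp add: exp_factor_def exp_add[symmetric] exp_of_real[symmetric] algebra_simps del: exp_of_real)
  have G: "Gamma (b + 1 + 3/10) = (b + 3/10) * Gamma (b + 3/10)"
          "Gamma (b + 1 + 7/10) = (b + 7/10) * Gamma (b + 7/10)"
    using Gamma_plus1[of "b + 3/10"] Gamma_plus1[of "b + 7/10"] assms
    by (simp_all add: Re_pos_not_nonpos_Int add_ac)
  have r: "(b + 1/4) * rGamma (b + 1 + 1/4) = rGamma (b + 1/4)"
          "(b + 3/4) * rGamma (b + 1 + 3/4) = rGamma (b + 3/4)"
    using rGamma_plus1[of "b + 1/4"] rGamma_plus1[of "b + 3/4"] by (simp_all add: add_ac)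
  have "side_ratio (b + 1) = ((b + 3/10) * (b + 7/10) * hypergeo_side (b + 1)) * inverse (exp_factor (b + 1)) *
     (Gamma (b + 3/10) * Gamma (b + 7/10) * (rGamma (b + 1 + 1/4) * rGamma (b + 1 + 3/4)))"
    unfolding side_ratio_def G by (simp add: mult_ac)
  also have "\<dots> = hypergeo_side b * (of_real (exp log_multiplier) * inverse (exp_factor (b + 1))) *
     (Gamma (b + 3/10) * Gamma (b + 7/10) * (((b + 1/4) * rGamma (b + 1 + 1/4)) * ((b + 3/4) * rGamma (b + 1 + 3/4))))"
    unfolding hypergeo_side_plus1[OF assms] by (simp only: mult_ac)
  also have "of_real (exp log_multiplier) * inverse (exp_factor (b + 1)) = inverse (exp_factor b)"
    unfolding sc by simp
  finally show ?thesis
    unfolding r side_ratio_def by simp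
qed

lemma holomorphic_on_hypergeo_side:
  assumes "open S" "\<And>b. b \<in> S \<Longrightarrow> 2 * b + 1 / 2 \<notin> \<int>\<^sub>\<le>\<^sub>0"
  shows   "hypergeo_side holomorphic_on S"
  unfolding hypergeo_side_def[abs_def]
proof (rule holomorphic_on_hypergeo_F)
  show "norm (complex_of_real (9 - 4 * sqrt 5)) < 1"
    using arg_bounds unfolding norm_of_real by linarith
qed (use assms in \<open>auto intro!: holomorphic_intros\<close>)

lemma holomorphic_on_side_ratio: "side_ratio holomorphic_on {b. Re b > 0}"
proof -
  have "hypergeo_side holomorphic_on {b. Re b > 0}"
    by (intro holomorphic_on_hypergeo_side open_halfspace_Re_gt Re_pos_not_nonpos_Int) auto
  thus ?thesis
    unfolding side_ratio_def[abs_def] exp_factor_def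
    by (intro holomorphic_intros) (auto dest!: nonpos_Int_Re_le)
qed

text \<open>
  The binomial domination gives exponential growth in \<open>|1 - 3 b|\<close> with rate
  \<open>- ln (1 - x) < ln 2 < 1\<close>, hence type at most \<open>3 < 2 \<pi>\<close> in \<open>Im b\<close>; all other factors are
  bounded on the strip.
\<close>

lemma side_ratio_bound:
  obtains C where "\<And>b. 1/2 \<le> Re b \<Longrightarrow> Re b \<le> 3/2 \<Longrightarrow> norm (side_ratio b) \<le> C * exp (3 * \<bar>Im b\<bar>)"
proof -
  obtain M where M: "\<And>z::complex. Re z \<ge> 0 \<Longrightarrow>
    norm (Gamma (z + 3/10) * Gamma (z + 7/10) * (rGamma (z + 1/4) * rGamma (z + 3/4))) \<le> M"
    by (rule Gamma_ratio_bounded) (rule that)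
  define K where "K = exp (\<bar>log_multiplier\<bar> * (3/2) + \<bar>ln 2 / 2 - 2 * ln (sqrt 5 - 1)\<bar>)"
  show ?thesis
  proof (rule that)
    fix b :: complex assume b: "1/2 \<le> Re b" "Re b \<le> 3/2"
    define x where "x = 9 - 4 * sqrt 5"
    have x: "0 < x" "x < 1/2"
      using arg_bounds by (auto simp: x_def)
    have "norm (1/2 - b + of_nat n) \<le> norm (2 * b + 1/2 + of_nat n)" for n
      unfolding norm_complex_def
      using b by (intro real_sqrt_le_mono add_mono) (auto simp: abs_le_square_iff[symmetric])
    hence "norm (hypergeo_side b) \<le> (1 - norm (complex_of_real x)) powr (- norm (1 - 3 * b))"
      unfolding hypergeo_side_def x_def[symmetric] using x by (intro norm_hypergeo_F_le) auto
    also have "\<dots> = exp (norm (1 - 3 * b) * - ln (1 - x))"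
      using x by (simp add: powr_def)
    also have "\<dots> \<le> exp ((6 + 3 * \<bar>Im b\<bar>) * 1)"
    proof (intro exp_mono mult_mono)
      have "norm (1 - 3 * b) \<le> norm (1 :: complex) + norm (3 * b)"
        by (rule norm_triangle_ineq4)
      also have "norm (3 * b) = 3 * norm b"
        by (simp add: norm_mult)
      also have "norm b \<le> \<bar>Re b\<bar> + \<bar>Im b\<bar>"
        by (rule cmod_le)
      finally show "norm (1 - 3 * b) \<le> 6 + 3 * \<bar>Im b\<bar>"
        using b by simp
      have "exp (-1 :: real) \<le> 1/2"
        using exp_ge_add_one_self[of "1::real"] by (simp add: exp_minus field_simps)
      also have "1/2 \<le> 1 - x"
        using x by simp
      finally have "-1 \<le> ln (1 - x)"
        using x by (subst ln_ge_iff) auto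
      thus "- ln (1 - x) \<le> 1"
        by simp
      show "0 \<le> - ln (1 - x)"
        using x by simp
    qed auto
    finally have 1: "norm (hypergeo_side b) \<le> exp 6 * exp (3 * \<bar>Im b\<bar>)"
      by (simp add: exp_add)
    have "- (log_multiplier * Re b) \<le> \<bar>log_multiplier\<bar> * \<bar>Re b\<bar>"
      by (metis abs_ge_minus_self abs_mult)
    also have "\<dots> \<le> \<bar>log_multiplier\<bar> * (3/2)"
      using b by (intro mult_left_mono) auto
    finally have "norm (inverse (exp_factor b)) \<le> K"
      unfolding exp_factor_def K_def exp_minus[symmetric] norm_exp_eq_Re by simp
    hence "norm (side_ratio b) \<le> (exp 6 * exp (3 * \<bar>Im b\<bar>)) * K * M"
      unfolding side_ratio_def norm_mult[of "hypergeo_side b * _"] norm_mult[of "hypergeo_side b"]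
      using b 1 by (intro mult_mono M) (auto simp: K_def)
    thus "norm (side_ratio b) \<le> (exp 6 * K * M) * exp (3 * \<bar>Im b\<bar>)"
      by (simp add: mult_ac)
  qed
qed

text \<open>
  At \<open>b = 1/2\<close> the second parameter of the series is \<open>0\<close>, so the series is \<open>1\<close>. The Gamma values are
  \<open>\<Gamma>(1/5) \<Gamma>(4/5)\<close> and \<open>\<Gamma>(1/4) \<Gamma>(3/4)\<close> up to rational factors, which the reflection formula
  evaluates; this is where \<open>sin (\<pi> / 5)\<close> enters.
\<close>

lemma side_ratio_half: "side_ratio (1/2) = 1"
proof -
  define \<sigma> where "\<sigma> = sin (pi / 5)"
  define k where "k = exp (- (log_multiplier / 2 + (ln 2 / 2 - 2 * ln (sqrt 5 - 1))))"
  have \<sigma>: "\<sigma> > 0" "\<sigma>\<^sup>2 = (5 - sqrt 5) / 8"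
    unfolding \<sigma>_def by (auto intro!: sin_gt_zero simp: sin_pi_fifth_squared)
  have "hypergeo_term (1 - 3 * (1/2)) (1/2 - 1/2) c x n = 0" if "n \<noteq> 0" for c x n
    using that by (simp add: hypergeo_term_def pochhammer_0_left)
  hence lhs: "hypergeo_side (1/2) = 1"
    unfolding hypergeo_side_def hypergeo_F_def
    by (subst suminf_finite[of "{0}"]) (auto simp: hypergeo_term_def)
  have scale: "inverse (exp_factor (1/2)) = of_real k"
    by (simp add: exp_factor_def k_def exp_of_real[symmetric] exp_minus[symmetric])
  have "Gamma (1/5) * Gamma (4/5) = complex_of_real (pi / \<sigma>)"
    using Gamma_reflection_complex[of "1/5"] sin_of_real[of "pi / 5", where 'a = complex]
    by (simp add: \<sigma>_def)
  moreover have "Gamma (4/5) * Gamma (6/5 :: complex) = 1/5 * (Gamma (1/5) * Gamma (4/5))"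
    using Gamma_plus1[of "1/5 :: complex"] Re_pos_not_nonpos_Int[of "1/5"] by simp
  ultimately have G: "Gamma (1/2 + 3/10) * Gamma (1/2 + 7/10) = complex_of_real (pi / (5 * \<sigma>))"
    by simp
  have "rGamma (1/4) * rGamma (3/4) = complex_of_real (sqrt 2 / 2 / pi)"
  proof -
    have "sin (complex_of_real pi * (1/4)) = complex_of_real (sqrt 2 / 2)"
      using sin_of_real[of "pi / 4", where 'a = complex] by (simp add: sin_45)
    hence "rGamma (1/4) * rGamma (1 - 1/4) = complex_of_real (sqrt 2 / 2) / of_real pi"
      unfolding rGamma_reflection_complex by (rule arg_cong)
    thus ?thesis by simp
  qed
  moreover have "rGamma (5/4 :: complex) = 4 * rGamma (1/4)"
    using rGamma_plus1[of "1/4 :: complex"] by simp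
  ultimately have r: "rGamma (1/2 + 1/4) * rGamma (1/2 + 3/4) = complex_of_real (2 * sqrt 2 / pi)"
    by (simp add: mult_ac)
  have "side_ratio (1/2) = of_real (k * (pi / (5 * \<sigma>) * (2 * sqrt 2 / pi)))"
    unfolding side_ratio_def lhs scale G r by simp
  also have "k * (pi / (5 * \<sigma>) * (2 * sqrt 2 / pi)) = k * (2 * sqrt 2) / (5 * \<sigma>)"
    by simp
  also have "\<dots> = 1"
  proof -
    define s where "s = sqrt 5"
    have s: "s > 2" "s < 9/4" "s\<^sup>2 = 5"
      using sqrt5_bounds by (auto simp: s_def)
    have "k\<^sup>2 = exp (ln ((s - 1) ^ 4 / (2 * exp log_multiplier)))"
      using s(1) by (simp add: k_def s_def[symmetric] exp_double[symmetric] ln_mult ln_div ln_realpow algebra_simps)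
    also have "\<dots> = (s - 1) ^ 4 / (2 * (256 * (5 - 2 * s) / 125))"
    proof -
      have "(s - 1) ^ 4 / (2 * exp log_multiplier) > 0"
        using s(1) by simp
      thus ?thesis
        by (subst exp_ln) (simp_all only: exp_log_multiplier s_def)
    qed
    finally have k2: "k\<^sup>2 = (s - 1) ^ 4 / (2 * (256 * (5 - 2 * s) / 125))" .
    have "(k * (2 * sqrt 2) / (5 * \<sigma>))\<^sup>2 = k\<^sup>2 * 8 / (25 * \<sigma>\<^sup>2)"
      by (simp add: power_divide power_mult_distrib)
    also have "\<dots> = 1"
    proof -
      have "(s - 1)\<^sup>2 = 6 - 2 * s"
        using s(3) by (simp add: power2_diff)
      hence "(s - 1) ^ 4 = (6 - 2 * s)\<^sup>2"
        by (metis power_mult mult_2 numeral_Bit0)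
      also have "\<dots> = 56 - 24 * s"
        using s(3) by (simp add: power2_diff power_mult_distrib)
      finally have "(s - 1) ^ 4 * 125 * 64 = 512 * 125 * (7 - 3 * s)"
        by simp
      also have "\<dots> = 512 * (5 - 2 * s) * (25 * (5 - s))"
        using s(3) by (simp add: algebra_simps power2_eq_square)
      finally have eq: "(s - 1) ^ 4 * 125 * 64 = 512 * (5 - 2 * s) * (25 * (5 - s))" .
      have "A / (2 * (256 * X / 125)) * 8 / (25 * (Y / 8)) = A * 125 * 64 / (512 * X * (25 * Y))"
        for A X Y :: real
        by (cases "X = 0"; cases "Y = 0") (simp_all add: field_simps)
      hence "k\<^sup>2 * 8 / (25 * \<sigma>\<^sup>2) = (s - 1) ^ 4 * 125 * 64 / (512 * (5 - 2 * s) * (25 * (5 - s)))"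
        unfolding k2 \<sigma>(2) s_def[symmetric] .
      also have "\<dots> = 1"
        unfolding eq using s(1,2) by simp
      finally show ?thesis .
    qed
    finally have "(k * (2 * sqrt 2) / (5 * \<sigma>))\<^sup>2 = 1" .
    hence "k * (2 * sqrt 2) / (5 * \<sigma>) = 1 \<or> k * (2 * sqrt 2) / (5 * \<sigma>) = -1"
      by (simp only: power2_eq_1_iff)
    moreover have "k * (2 * sqrt 2) / (5 * \<sigma>) > 0"
      using \<sigma>(1) by (simp add: k_def)
    ultimately show ?thesis
      by linarith
  qed
  finally show ?thesis by simp
qed

lemma side_ratio_eq_1:
  assumes "Re b > 0"
  shows   "side_ratio b = 1"
proof -
  obtain C where C: "\<And>b. 1/2 \<le> Re b \<Longrightarrow> Re b \<le> 3/2 \<Longrightarrow> norm (side_ratio b) \<le> C * exp (3 * \<bar>Im b\<bar>)"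
    by (rule side_ratio_bound) (rule that)
  obtain c where c: "\<And>z. Re z > 0 \<Longrightarrow> side_ratio z = c"
    using periodic_exponential_type_constant[OF holomorphic_on_side_ratio side_ratio_plus1 C] pi_gt3
    by auto
  show ?thesis
    using c[of "1/2"] c[OF assms] side_ratio_half by simp
qed

definition Gamma_side :: "complex \<Rightarrow> complex" where
  "Gamma_side b = exp_factor b * (Gamma (b + 1/4) * Gamma (b + 3/4)) * (rGamma (b + 3/10) * rGamma (b + 7/10))"

lemma sides_agree_right_half_plane:
  assumes "Re b > 0"
  shows   "hypergeo_side b = Gamma_side b"
proof -
  have "Gamma (b + c) \<noteq> 0" if "Re c \<ge> 0" for c
    using assms that by (auto simp: Gamma_eq_zero_iff Re_pos_not_nonpos_Int)
  from this[of "1/4"] this[of "3/4"] this[of "3/10"] this[of "7/10"] show ?thesis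
    using side_ratio_eq_1[OF assms]
    by (simp add: side_ratio_def Gamma_side_def exp_factor_def rGamma_inverse_Gamma field_simps)
qed

text \<open>
  Both sides are holomorphic in \<open>b\<close> off the countable closed set where the third parameter is a
  non-positive integer. Its complement is connected, so agreement on the right half-plane suffices.
\<close>

lemma sides_agree:
  assumes "2 * b + 1 / 2 \<notin> \<int>\<^sub>\<le>\<^sub>0"
  shows   "hypergeo_side b = Gamma_side b"
proof -
  define P :: "complex set" where "P = {b. 2 * b + 1 / 2 \<in> \<int>\<^sub>\<le>\<^sub>0}"
  have "closed ((\<lambda>b::complex. 2 * b + 1 / 2) -` \<int>\<^sub>\<le>\<^sub>0)"
    by (intro closed_vimage closed_nonpos_Ints continuous_intros)
  hence op: "open (- P)"
    by (simp add: P_def vimage_def open_Compl)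
  have "P \<subseteq> range (\<lambda>n::nat. (- of_nat n - 1/2) / 2)"
  proof
    fix b assume "b \<in> P"
    then obtain n :: nat where "2 * b + 1 / 2 = - of_nat n"
      by (auto simp: P_def elim!: nonpos_Ints_cases')
    hence "b = (- of_nat n - 1/2) / 2"
      by (simp add: algebra_simps)
    thus "b \<in> range (\<lambda>n::nat. (- of_nat n - 1/2) / 2)" by blast
  qed
  hence "countable P"
    by (rule countable_subset) auto
  hence conn: "connected (- P)"
    using connected_open_diff_countable[of UNIV P] connected_UNIV by (simp add: Compl_eq_Diff_UNIV)
  have hol: "hypergeo_side holomorphic_on - P"
    by (rule holomorphic_on_hypergeo_side[OF op]) (auto simp: P_def)
  have hol': "Gamma_side holomorphic_on - P"
    unfolding Gamma_side_def[abs_def] exp_factor_def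
    by (intro holomorphic_intros) (use quarter_shifts_not_nonpos_Int in \<open>auto simp: P_def\<close>)
  show ?thesis
  proof (rule analytic_continuation_open[OF open_halfspace_Re_gt[of 0] op _ conn _ hol hol'])
    show "{b. Re b > 0} \<noteq> {}"
      by (auto intro!: exI[of _ 1])
    show "{b. Re b > 0} \<subseteq> - P"
      by (auto simp: P_def dest!: nonpos_Int_Re_le)
  qed (use assms in \<open>auto simp: P_def sides_agree_right_half_plane\<close>)
qed

theorem mainTheorem20:
  fixes a :: complex
  assumes "2 / 3 * a + 1 / 2 \<notin> \<int>\<^sub>\<le>\<^sub>0"
  shows "hypergeo_F (1 - a) (1 / 2 - 1 / 3 * a) (2 / 3 * a + 1 / 2) (of_real (9 - 4 * sqrt 5)) =
    (of_real 5 powr (- 5 * a / 6) * of_real (sqrt 5 - 1) powr (a - 2)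
       * Gamma (1 / 3 * a + 1 / 4) * Gamma (1 / 3 * a + 3 / 4))
    * rGamma (1 / 3 * a + 3 / 10) * rGamma (1 / 3 * a + 7 / 10)
    / of_real 2 powr (- 5 * a / 3 - 1 / 2)"
proof -
  define b where "b = 1 / 3 * a"
  have a: "a = 3 * b" by (simp add: b_def)
  have eq: "hypergeo_side b = Gamma_side b"
    using assms by (intro sides_agree) (simp add: a)
  have powr: "complex_of_real r powr z = exp (z * of_real (ln r))" if "r > 0" for r z
    using that by (simp add: powr_def Ln_of_real)
  have "of_real 5 powr (- 5 * a / 6) * of_real (sqrt 5 - 1) powr (a - 2) / of_real 2 powr (- 5 * a / 3 - 1 / 2) =
        exp_factor b"
  proof -
    have "sqrt 5 - 1 > 0" by simp
    have "ln (sqrt 5) = ln 5 / 2" by (simp add: ln_sqrt)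
    show ?thesis
      unfolding powr[OF zero_less_numeral] powr[OF \<open>sqrt 5 - 1 > 0\<close>] exp_add[symmetric] exp_diff[symmetric]
        exp_factor_def log_multiplier_def \<open>ln (sqrt 5) = ln 5 / 2\<close> a
      by (rule arg_cong[of _ _ exp]) (simp add: field_simps)
  qed
  with eq show ?thesis
    unfolding hypergeo_side_def Gamma_side_def by (simp add: a mult_ac field_simps)
qed

end
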